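(* Let $\lambda\in(0,1)$ and let $X$ be a random variable with the degenerate gamma distribution $\Gamma_\lambda(1,1)$, i.e. with probability density $f_\lambda(x)=\frac{1}{\Gamma_\lambda(1)}e_\lambda^{-1}(x)=(1-\lambda)(1+\lambda x)^{-1/\lambda}$ for $x\ge0$ and $f_\lambda(x)=0$ for $x<0$. Then for every integer $n\ge0$, $$E\bigg[\frac{1}{1+\lambda X}\bigg(\frac{1}{\lambda}\log(1+\lambda X)\bigg)^{n}\bigg]=(1-\lambda)\sum_{l=0}^{n}\binom{n}{l}d_{l,\lambda}\,(1)_{n-l,\lambda}.$$
   Context: For a nonzero real $\lambda$, the degenerate falling factorial is $(x)_{0,\lambda}=1$ and $(x)_{n,\lambda}=x(x-\lambda)\cdots(x-(n-1)\lambda)$ for $n\ge1$. The degenerate exponential function is $e_{\lambda}^{x}(t)=(1+\lambda t)^{x/\lambda}=\sum_{n\ge0}(x)_{n,\lambda}\frac{t^n}{n!}$. The degenerate gamma function is $\Gamma_\lambda(s)=\int_0^\infty e_\lambda^{-1}(t)t^{s-1}\,dt$, so that $\Gamma_\lambda(1)=\frac{1}{1-\lambda}$. The degenerate derangement polynomials $d_{n,\lambda}(x)$ are defined by $\frac{1}{1-t}e_{\lambda}^{x-1}(t)=\sum_{n\ge0}d_{n,\lambda}(x)\frac{t^n}{n!}$, and the degenerate derangement numbers are $d_{n,\lambda}=d_{n,\lambda}(0)$. *)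

theory Defs
  imports
    "HOL-Probability.Probability"
    "HOL-Computational_Algebra.Formal_Power_Series"
begin

definition deg_falling :: "real \<Rightarrow> real \<Rightarrow> nat \<Rightarrow> real" where
  "deg_falling l x n = (\<Prod>i<n. x - real i * l)"

text \<open>The degenerate exponential occurs in two roles: as a real function (meaningful where
  \<open>1 + l * t > 0\<close>) and as the exponential generating function of the degenerate falling
  factorials. Lemma \<open>deg_exp_sums\<close> below relates the two.\<close>

definition deg_exp :: "real \<Rightarrow> real \<Rightarrow> real \<Rightarrow> real" where
  "deg_exp l x t = (1 + l * t) powr (x / l)"

definition deg_exp_fps :: "real \<Rightarrow> real \<Rightarrow> real fps" where
  "deg_exp_fps l x = Abs_fps (\<lambda>n. deg_falling l x n / fact n)"

definition deg_derangement_poly :: "real \<Rightarrow> nat \<Rightarrow> real \<Rightarrow> real" where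
  "deg_derangement_poly l n x = fact n * fps_nth (1 / (1 - fps_X) * deg_exp_fps l (x - 1)) n"

definition deg_derangement :: "real \<Rightarrow> nat \<Rightarrow> real" where
  "deg_derangement l n = deg_derangement_poly l n 0"

definition deg_gamma :: "real \<Rightarrow> real \<Rightarrow> real" where
  "deg_gamma l s = (LBINT t:{0<..}. deg_exp l (-1) t * t powr (s - 1))"

text \<open>Density of the degenerate gamma distribution with parameters \<open>(1,1)\<close>.\<close>

definition deg_gamma_density_1_1 :: "real \<Rightarrow> real \<Rightarrow> real" where
  "deg_gamma_density_1_1 l x = (if x < 0 then 0 else 1 / deg_gamma l 1 * deg_exp l (-1) x)"

lemma deg_exp_sums:
  assumes "l \<noteq> 0" and "\<bar>l * t\<bar> < 1"
  shows "(\<lambda>n. fps_nth (deg_exp_fps l x) n * t ^ n) sums deg_exp l x t"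
proof -
  have "fps_nth (deg_exp_fps l x) n * t ^ n = ((x / l) gchoose n) * (l * t) ^ n" for n
  proof -
    have "deg_falling l x n = (\<Prod>i<n. l * (x / l - real i))"
      unfolding deg_falling_def using assms(1) by (intro prod.cong) (auto simp: field_simps)
    also have "\<dots> = l ^ n * (\<Prod>i<n. x / l - real i)"
      by (simp add: prod.distrib)
    finally show ?thesis
      by (simp add: deg_exp_fps_def gbinomial_prod_rev power_mult_distrib lessThan_atLeast0)
  qed
  thus ?thesis
    using gen_binomial_real[OF assms(2), of "x / l"] by (simp add: deg_exp_def)
qed

lemma deg_derangement_poly_egf:
  "Abs_fps (\<lambda>n. deg_derangement_poly l n x / fact n) = 1 / (1 - fps_X) * deg_exp_fps l (x - 1)"
  by (simp add: fps_eq_iff deg_derangement_poly_def)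

lemma deg_gamma_1:
  assumes "0 < l" "l < 1"
  shows "deg_gamma l 1 = 1 / (1 - l)"
proof -
  define F where "F = (\<lambda>t::real. - ((1 + l * t) powr (1 - 1 / l) / (1 - l)))"
  have "(LBINT t=ereal 0..\<infinity>. deg_exp l (-1) t) = 0 - (- 1 / (1 - l))"
  proof (rule interval_integral_FTC_nonneg[where F = F])
    show "DERIV F t :> deg_exp l (-1) t" if "ereal 0 < ereal t" for t
    proof -
      have "1 + l * t > 0" using that assms by (simp add: add_pos_pos)
      hence "((\<lambda>t. (1 + l * t) powr (1 - 1 / l)) has_real_derivative
          (1 - 1 / l) * (1 + l * t) powr (1 - 1 / l - 1) * l) (at t)"
        by (auto intro!: derivative_eq_intros)
      hence "DERIV F t :> - ((1 - 1 / l) * (1 + l * t) powr (1 - 1 / l - 1) * l / (1 - l))"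
        unfolding F_def by (intro DERIV_minus DERIV_cdivide)
      moreover have "- ((1 - 1 / l) * (1 + l * t) powr (1 - 1 / l - 1) * l / (1 - l)) =
          - ((1 - 1 / l) * l / (1 - l)) * (1 + l * t) powr (- 1 / l)"
        by simp
      moreover have "- ((1 - 1 / l) * l / (1 - l)) = 1"
        using assms by (simp add: field_simps)
      ultimately show ?thesis by (simp add: deg_exp_def)
    qed
    show "isCont (deg_exp l (-1)) t" if "ereal 0 < ereal t" for t
    proof -
      have "1 + l * t > 0" using that assms by (simp add: add_pos_pos)
      thus ?thesis unfolding deg_exp_def by (intro continuous_intros) auto
    qed
    show "((F \<circ> real_of_ereal) \<longlongrightarrow> - 1 / (1 - l)) (at_right (ereal 0))"
      unfolding ereal_tendsto_simps
      unfolding F_def using assms by (auto intro!: tendsto_eq_intros)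
    show "((F \<circ> real_of_ereal) \<longlongrightarrow> 0) (at_left \<infinity>)"
    proof -
      have a: "1 - 1 / l < 0" using assms by (simp add: field_simps)
      have "filterlim (\<lambda>t. 1 + l * t) at_top at_top"
        using assms
        by (intro filterlim_tendsto_add_at_top[OF tendsto_const]
            filterlim_tendsto_pos_mult_at_top[OF tendsto_const]) (auto intro: filterlim_ident)
      from tendsto_neg_powr[OF a this] have "(F \<longlongrightarrow> - (0 / (1 - l))) at_top"
        unfolding F_def using assms by (intro tendsto_intros) auto
      thus ?thesis unfolding ereal_tendsto_simps by simp
    qed
  qed (auto simp: deg_exp_def)
  moreover have "(LBINT t=ereal 0..\<infinity>. deg_exp l (-1) t) = deg_gamma l 1"
    unfolding deg_gamma_def interval_lebesgue_integral_def set_lebesgue_integral_def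
    by (auto simp: einterval_def indicator_def intro!: Bochner_Integration.integral_cong)
  ultimately show ?thesis by simp
qed

lemma deg_gamma_density_1_1_eq:
  assumes "0 < l" "l < 1"
  shows "deg_gamma_density_1_1 l x = (if x < 0 then 0 else (1 - l) * (1 + l * x) powr (- 1 / l))"
  using deg_gamma_1[OF assms] by (simp add: deg_gamma_density_1_1_def deg_exp_def)

end

theory Submission
  imports
    Defs
    "HOL-Real_Asymp.Real_Asymp"
begin

text \<open>After the substitution \<open>y = ln (1 + l * x) / l\<close> the expectation becomes
  \<open>(1 - l)\<close> times the Gamma integral of \<open>y ^ n * exp (- y)\<close>, that is \<open>(1 - l) * fact n\<close>. On the
  other side, the binomial convolution of \<open>deg_derangement l\<close> with \<open>deg_falling l 1\<close> has the
  generating function \<open>1 / (1 - t) * e\<^sub>l\<^sup>-\<^sup>1(t) * e\<^sub>l(t) = 1 / (1 - t)\<close>, so it also equals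
  \<open>fact n\<close>.\<close>

text \<open>Pulling \<open>l\<close> out of each of the \<open>n\<close> factors turns the
  coefficients of \<open>deg_exp_fps\<close> into generalized binomial coefficients, for which
  Vandermonde's identity is available.\<close>

lemma deg_falling_eq_gbinomial:
  assumes "l \<noteq> 0"
  shows "deg_falling l x n / fact n = l ^ n * ((x / l) gchoose n)"
proof -
  have "deg_falling l x n = (\<Prod>i<n. l * (x / l - real i))"
    unfolding deg_falling_def using assms by (intro prod.cong) (auto simp: field_simps)
  also have "\<dots> = l ^ n * (\<Prod>i<n. x / l - real i)"
    by (simp add: prod.distrib)
  finally show ?thesis
    by (simp add: gbinomial_prod_rev lessThan_atLeast0)
qed

text \<open>Since \<open>l ^ k * l ^ (n - k) = l ^ n\<close>, the power of \<open>l\<close> leaves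
  the Cauchy product, and what remains is Vandermonde's identity for \<open>x / l\<close> and
  \<open>y / l\<close>.\<close>

lemma deg_exp_fps_add:
  assumes "l \<noteq> 0"
  shows "deg_exp_fps l x * deg_exp_fps l y = deg_exp_fps l (x + y)"
proof (rule fps_ext)
  fix n
  have "fps_nth (deg_exp_fps l x * deg_exp_fps l y) n =
      (\<Sum>k=0..n. l ^ n * (((x / l) gchoose k) * ((y / l) gchoose (n - k))))"
    unfolding fps_mult_nth deg_exp_fps_def fps_nth_Abs_fps deg_falling_eq_gbinomial[OF assms]
  proof (intro sum.cong refl)
    fix k assume "k \<in> {0..n}"
    hence "l ^ n = l ^ k * l ^ (n - k)"
      by (simp flip: power_add)
    thus "l ^ k * ((x / l) gchoose k) * (l ^ (n - k) * ((y / l) gchoose (n - k))) =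
        l ^ n * (((x / l) gchoose k) * ((y / l) gchoose (n - k)))"
      by (simp only: mult_ac)
  qed
  also have "\<dots> = fps_nth (deg_exp_fps l (x + y)) n"
    by (simp add: deg_exp_fps_def deg_falling_eq_gbinomial[OF assms] gbinomial_Vandermonde
        add_divide_distrib flip: sum_distrib_left)
  finally show "fps_nth (deg_exp_fps l x * deg_exp_fps l y) n = fps_nth (deg_exp_fps l (x + y)) n" .
qed

lemma deg_exp_fps_0: "deg_exp_fps l 0 = 1"
proof (rule fps_ext)
  fix n
  show "fps_nth (deg_exp_fps l 0) n = fps_nth 1 n"
    \<comment> \<open>For \<open>n > 0\<close> the vanishing factor is the first one,
      \<open>i = 0\<close>, so the product is split at the front and not at the back.\<close>
    by (cases n) (simp_all add: deg_exp_fps_def deg_falling_def prod.lessThan_Suc_shift del: prod.lessThan_Suc)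
qed

lemma deg_derangement_convolution:
  assumes "l \<noteq> 0"
  shows "(\<Sum>k=0..n. real (n choose k) * deg_derangement l k * deg_falling l 1 (n - k)) = fact n"
proof -
  let ?G = "1 / (1 - fps_X) :: real fps"
  have "(\<Sum>k=0..n. real (n choose k) * deg_derangement l k * deg_falling l 1 (n - k)) =
      fact n * fps_nth (?G * deg_exp_fps l (-1) * deg_exp_fps l 1) n"
    \<comment> \<open>Only the outer product is expanded: \<open>?G * deg_exp_fps l (-1)\<close>
      stays whole because its coefficients are \<open>deg_derangement l k / fact k\<close>.\<close>
    unfolding fps_mult_nth[of "?G * _"] sum_distrib_left
    by (intro sum.cong) (auto simp: deg_derangement_def deg_derangement_poly_def deg_exp_fps_def[of l 1]
        binomial_fact field_simps)
  also have "?G * deg_exp_fps l (-1) * deg_exp_fps l 1 = ?G"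
    using deg_exp_fps_add[OF assms, of "-1" 1] by (simp add: mult.assoc deg_exp_fps_0)
  also have "fps_nth ?G n = 1"
    \<comment> \<open>\<open>1 - fps_X\<close> is read as the inverse of the series with all
      coefficients 1, so \<open>?G\<close> is that series.\<close>
    by (simp add: fps_divide_unit flip: fps_inverse_gp')
  finally show ?thesis by simp
qed

text \<open>For \<open>k > 0\<close> the summand \<open>exp (- y) * y ^ k / fact k\<close> has as
  derivative a difference of consecutive terms, so the sum telescopes to its last term. This yields
  an antiderivative of the Gamma integrand.\<close>

lemma DERIV_exp_times_exp_partial_sum:
  "((\<lambda>y. exp (- y) * (\<Sum>k\<le>n. y ^ k / fact k)) has_real_derivative - (exp (- y) * y ^ n / fact n)) (at y)"
proof (induction n)
  case 0
  show ?case by (auto intro!: derivative_eq_intros)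
next
  case (Suc n)
  have "((\<lambda>y::real. exp (- y) * (y ^ Suc n / fact (Suc n))) has_real_derivative
      exp (- y) * y ^ n / fact n - exp (- y) * y ^ Suc n / fact (Suc n)) (at y)"
  proof -
    have "((\<lambda>y::real. y ^ Suc n / fact (Suc n)) has_real_derivative y ^ n / fact n) (at y)"
      using DERIV_cdivide[OF DERIV_pow[of "Suc n" y], of "fact (Suc n)"]
      by (simp add: divide_simps del: power_Suc of_nat_Suc)
    moreover have "((\<lambda>y::real. exp (- y)) has_real_derivative - exp (- y)) (at y)"
      by (auto intro!: derivative_eq_intros)
    ultimately show ?thesis
      using DERIV_mult[of "\<lambda>y. exp (- y)" "- exp (- y)" y UNIV
          "\<lambda>y. y ^ Suc n / fact (Suc n)" "y ^ n / fact n"]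
      by (simp add: mult.commute del: power_Suc fact_Suc)
  qed
  from DERIV_add[OF Suc.IH this] show ?case
    by (simp add: distrib_left del: power_Suc fact_Suc)
qed

text \<open>With \<open>u = ln (1 + l * x) / l\<close>, the power is \<open>exp (- u)\<close> and
  \<open>1 / (1 + l * x)\<close> is the derivative of \<open>u\<close>, so the chain rule gives an
  antiderivative. As the integrand is nonnegative on the half-line, a finite value also yields
  integrability.\<close>

lemma has_bochner_integral_log_moment:
  fixes l :: real
  assumes "0 < l"
  shows "has_bochner_integral lborel
    (\<lambda>x. (1 + l * x) powr (- 1 / l) / (1 + l * x) * (ln (1 + l * x) / l) ^ n * indicator {0..} x)
    (fact n)"
proof (rule has_bochner_integral_nn_integral)
  let ?u = "\<lambda>x. ln (1 + l * x) / l"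
  let ?f = "\<lambda>x. (1 + l * x) powr (- 1 / l) / (1 + l * x) * ?u x ^ n"
  \<comment> \<open>The factor \<open>- fact n\<close> makes the derivative of \<open>?H\<close>
    exactly \<open>exp (- y) * y ^ n\<close>.\<close>
  let ?H = "\<lambda>y::real. - (fact n) * (exp (- y) * (\<Sum>k\<le>n. y ^ k / fact k))"
  show "AE x in lborel. 0 \<le> ?f x * indicator {0..} x"
    using assms by (intro AE_I2) (auto simp: indicator_def)
  have "((\<lambda>y::real. - fact n * (\<Sum>k\<le>n. y ^ k / exp y / fact k)) \<longlongrightarrow> - fact n * (\<Sum>k\<le>n. 0 / fact k)) at_top"
    by (intro tendsto_mult tendsto_const tendsto_sum tendsto_divide tendsto_power_div_exp_0) simp
  hence "(?H \<longlongrightarrow> 0) at_top"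
    by (simp add: exp_minus field_simps sum_distrib_left sum_divide_distrib)
  moreover have "filterlim ?u at_top at_top"
    using assms by real_asymp
  ultimately have lim: "((\<lambda>x. ?H (?u x)) \<longlongrightarrow> 0) at_top"
    by (auto intro: filterlim_compose)
  have "(\<integral>\<^sup>+x. ennreal (?f x) * indicator {0..} x \<partial>lborel) = ennreal (0 - ?H (?u 0))"
  proof (rule nn_integral_FTC_atLeast[OF _ _ _ lim])
    fix x :: real assume "0 \<le> x"
    hence pos: "1 + l * x \<ge> 1" using assms by simp
    thus "0 \<le> ?f x" using assms by simp
    have "DERIV ?u x :> 1 / (1 + l * x)"
      using pos assms by (auto intro!: derivative_eq_intros)
    from DERIV_chain2[OF DERIV_cmult[OF DERIV_exp_times_exp_partial_sum, of "- fact n" n] this]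
    show "DERIV (\<lambda>x. ?H (?u x)) x :> ?f x"
      by (rule DERIV_cong) (use pos in \<open>simp add: powr_def\<close>)
  qed simp
  \<comment> \<open>Here \<open>?u 0 = 0\<close>, and only the summand \<open>k = 0\<close>
    survives, with \<open>0 ^ 0 = 1\<close>.\<close>
  also have "0 - ?H (?u 0) = fact n"
    by (simp add: sum.atMost_shift)
  finally show "(\<integral>\<^sup>+x. ennreal (?f x * indicator {0..} x) \<partial>lborel) = ennreal (fact n)"
    by (simp only: ennreal_mult'' indicator_pos_le ennreal_indicator)
qed simp_all

theorem theorem11:
  fixes l :: real and M :: "'a measure" and X :: "'a \<Rightarrow> real" and n :: nat
  assumes "0 < l" and "l < 1"
    and "prob_space M"
    and "distributed M lborel X (\<lambda>x. ennreal (deg_gamma_density_1_1 l x))"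
  shows "prob_space.expectation M
           (\<lambda>\<omega>. 1 / (1 + l * X \<omega>) * (1 / l * ln (1 + l * X \<omega>)) ^ n)
         = (1 - l) * (\<Sum>k=0..n. real (n choose k) * deg_derangement l k * deg_falling l 1 (n - k))"
proof -
  let ?g = "\<lambda>x. 1 / (1 + l * x) * (1 / l * ln (1 + l * x)) ^ n"
  have "prob_space.expectation M (\<lambda>\<omega>. ?g (X \<omega>)) = (\<integral>x. deg_gamma_density_1_1 l x * ?g x \<partial>lborel)"
    using assms by (intro distributed_integral[symmetric])
      (auto simp: deg_gamma_density_1_1_eq)
  \<comment> \<open>The case distinction in the density becomes the indicator of the half-line, and
    its normalizing constant is moved to the front.\<close>
  also have "\<dots> = (\<integral>x. (1 - l) * ((1 + l * x) powr (- 1 / l) / (1 + l * x) *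
      (ln (1 + l * x) / l) ^ n * indicator {0..} x) \<partial>lborel)"
    by (intro Bochner_Integration.integral_cong)
      (auto simp: deg_gamma_density_1_1_eq[OF assms(1,2)] indicator_def)
  also have "\<dots> = (1 - l) * fact n"
    by (intro has_bochner_integral_integral_eq has_bochner_integral_mult_right
        has_bochner_integral_log_moment assms)
  finally show ?thesis
    using assms(1) by (simp add: deg_derangement_convolution)
qed

end
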